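(* There exist a positive integer $n$ and binary marginals $\lambda_i,\mu_j,\nu_k\in\{0,1\}$ ($0\le i,j,k\le n-1$) for which there is a unique triangular contingency table of size $n$ with these marginals, and this table is not integer-valued (i.e. at least one of its entries is not an integer).
   Context: A triangular contingency table of size $n$ is an array $A$ of non-negative real numbers $a_{i,j,k}$, where $(i,j,k)$ ranges over all triples of non-negative integers with $i+j+k=n-1$. Its marginals are the $3n$ numbers $\lambda_i,\mu_j,\nu_k$ for $0\le i,j,k\le n-1$ given by $$\lambda_i=\sum_{j'+k'=n-1-i}a_{i,j',k'},\qquad \mu_j=\sum_{i'+k'=n-1-j}a_{i',j,k'},\qquad \nu_k=\sum_{i'+j'=n-1-k}a_{i',j',k},$$ where the summation indices are non-negative integers. *)

theory Defs
  imports Complex_Main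
begin

text \<open>Throughout, the size \<open>n\<close> is meant to be positive, so that the truncated
  natural-number subtractions \<open>n - 1\<close> and \<open>n - 1 - i\<close> (for \<open>i < n\<close>) are exact.\<close>

definition triangle_idx :: "nat \<Rightarrow> (nat \<times> nat \<times> nat) set" where
  "triangle_idx n = {(i, j, k). i + j + k = n - 1}"

text \<open>A table is an array indexed by the triples in \<open>triangle_idx n\<close> only; it is
  represented by a total function that is 0 elsewhere, so that equality of
  functions is equality of arrays.\<close>

definition triangular_table :: "nat \<Rightarrow> (nat \<Rightarrow> nat \<Rightarrow> nat \<Rightarrow> real) \<Rightarrow> bool" where
  "triangular_table n a \<longleftrightarrow>
     (\<forall>(i, j, k) \<in> triangle_idx n. a i j k \<ge> 0) \<and>
     (\<forall>i j k. (i, j, k) \<notin> triangle_idx n \<longrightarrow> a i j k = 0)"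

definition marginal1 :: "nat \<Rightarrow> (nat \<Rightarrow> nat \<Rightarrow> nat \<Rightarrow> real) \<Rightarrow> nat \<Rightarrow> real" where
  "marginal1 n a i = (\<Sum>(j', k') \<in> {(j', k'). j' + k' = n - 1 - i}. a i j' k')"

definition marginal2 :: "nat \<Rightarrow> (nat \<Rightarrow> nat \<Rightarrow> nat \<Rightarrow> real) \<Rightarrow> nat \<Rightarrow> real" where
  "marginal2 n a j = (\<Sum>(i', k') \<in> {(i', k'). i' + k' = n - 1 - j}. a i' j k')"

definition marginal3 :: "nat \<Rightarrow> (nat \<Rightarrow> nat \<Rightarrow> nat \<Rightarrow> real) \<Rightarrow> nat \<Rightarrow> real" where
  "marginal3 n a k = (\<Sum>(i', j') \<in> {(i', j'). i' + j' = n - 1 - k}. a i' j' k)"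

definition has_marginals ::
  "nat \<Rightarrow> (nat \<Rightarrow> nat \<Rightarrow> nat \<Rightarrow> real) \<Rightarrow> (nat \<Rightarrow> real) \<Rightarrow> (nat \<Rightarrow> real) \<Rightarrow> (nat \<Rightarrow> real) \<Rightarrow> bool" where
  "has_marginals n a lam mu nu \<longleftrightarrow>
     (\<forall>i<n. marginal1 n a i = lam i) \<and>
     (\<forall>j<n. marginal2 n a j = mu j) \<and>
     (\<forall>k<n. marginal3 n a k = nu k)"

definition integer_valued :: "nat \<Rightarrow> (nat \<Rightarrow> nat \<Rightarrow> nat \<Rightarrow> real) \<Rightarrow> bool" where
  "integer_valued n a \<longleftrightarrow> (\<forall>(i, j, k) \<in> triangle_idx n. a i j k \<in> \<int>)"

end

theory Submission
  imports Defs "HOL-Library.Indicator_Function"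
begin

text \<open>
  A marginal equal to 0 forces every entry on its line to vanish. Hence, if the marginals are the
  indicators of sets \<open>I\<close>, \<open>J\<close>, \<open>K\<close>, a table lives on the cells
  \<open>(i, j, k) \<in> I \<times> J \<times> K\<close> with \<open>i + j + k = n - 1\<close>. Suppose that every line with marginal 1
  contains exactly two of these cells. Taking cells as vertices and these lines as edges gives a
  cubic graph, properly edge-coloured by the three directions, and the marginal conditions
  say that the two ends of every edge have entries with sum 1. The constant 1/2 is always a
  solution. Along a path the deviation from 1/2 changes sign at every step, so around an odd
  cycle it equals its own negative and is 0: if every connected component contains an odd
  cycle, 1/2 is the only solution, and it is not integral.

  It remains to realise such a graph by cells of a triangle. This is possible for \<open>n = 14\<close> with
  \<open>I = {0, 1, 2, 4, 5, 6}\<close>, \<open>J = {0, 1, 3, 5, 7, 8}\<close> and \<open>K = {0, 2, 3, 9, 10, 12}\<close>. There are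
  twelve cells, and they split into four triangles of pairwise collinear cells. So the argument
  is particularly short here: three entries with pairwise sums 1 are all 1/2. The lemma
  \<open>support_in_cells\<close> confines every table to the twelve cells, and \<open>half_table_unique\<close> solves
  the equations on the four triangles.
\<close>

section \<open>Marginals of tables with small support\<close>

lemma finite_sum_pairs: "finite {(x, y). x + y = (m::nat)}"
  by (rule finite_subset[of _ "{..m} \<times> {..m}"]) auto

text \<open>The three marginals are the same operation up to a permutation of the coordinates, so
  facts about the first one transfer to the other two.\<close>

lemma marginal2_eq_marginal1: "marginal2 n a j = marginal1 n (\<lambda>j i k. a i j k) j"
  and marginal3_eq_marginal1: "marginal3 n a k = marginal1 n (\<lambda>k i j. a i j k) k"
  by (simp_all add: marginal1_def marginal2_def marginal3_def)

lemma triangular_table_permute: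
  assumes "triangular_table n a"
  shows "triangular_table n (\<lambda>j i k. a i j k)" "triangular_table n (\<lambda>k i j. a i j k)"
  using assms by (auto simp: triangular_table_def triangle_idx_def add_ac)

text \<open>Non-negativity enters here: a vanishing sum of non-negative entries has only zero
  summands.\<close>

lemma triangular_table_zero_line:
  assumes "triangular_table n a" "marginal1 n a i = 0"
  shows "a i j k = 0"
proof (cases "i + j + k = n - 1")
  case True
  have "\<forall>p \<in> {(j', k'). j' + k' = n - 1 - i}. (case p of (j', k') \<Rightarrow> a i j' k') = 0"
  proof (subst sum_nonneg_eq_0_iff[symmetric])
    show "(\<Sum>(j', k')\<in>{(j', k'). j' + k' = n - 1 - i}. a i j' k') = 0"
      using assms(2) by (simp add: marginal1_def)
  next
    fix p assume "p \<in> {(j', k'). j' + k' = n - 1 - i}"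
    with True assms(1) show "0 \<le> (case p of (j', k') \<Rightarrow> a i j' k')"
      by (auto simp: triangular_table_def triangle_idx_def)
  qed (rule finite_sum_pairs)
  with True show ?thesis by force
next
  case False
  with assms(1) show ?thesis by (simp add: triangular_table_def triangle_idx_def)
qed

text \<open>In the next three lemmas a marginal is written as a sum over the whole support instead of
  a line: when the support is an enumerated set, the simplifier evaluates such sums.\<close>

lemma marginal1_support:
  assumes "finite S" "S \<subseteq> triangle_idx n" "\<forall>i j k. (i, j, k) \<notin> S \<longrightarrow> a i j k = 0"
  shows "marginal1 n a i = (\<Sum>(x, y, z)\<in>S. if x = i then a x y z else 0)"
proof -
  have "marginal1 n a i = (\<Sum>c\<in>{c \<in> S. fst c = i}. case c of (x, y, z) \<Rightarrow> a x y z)"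
    unfolding marginal1_def
    by (rule sum.reindex_bij_witness_not_neutral
          [where i = snd and j = "Pair i" and T' = "{}"
             and S' = "{p. fst p + snd p = n - 1 - i \<and> (i, p) \<notin> S}"])
       (use assms in \<open>auto simp: triangle_idx_def finite_sum_pairs split_def
          intro: finite_subset[OF _ finite_sum_pairs[of "n - 1 - i"]]\<close>)
  also have "\<dots> = (\<Sum>c\<in>S. if fst c = i then case c of (x, y, z) \<Rightarrow> a x y z else 0)"
    using assms(1) by (rule sum.inter_filter)
  also have "\<dots> = (\<Sum>(x, y, z)\<in>S. if x = i then a x y z else 0)"
    by (rule sum.cong) auto
  finally show ?thesis .
qed

lemma marginal2_support:
  assumes "finite S" "S \<subseteq> triangle_idx n" "\<forall>i j k. (i, j, k) \<notin> S \<longrightarrow> a i j k = 0"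
  shows "marginal2 n a j = (\<Sum>(x, y, z)\<in>S. if y = j then a x y z else 0)"
proof -
  let ?p = "\<lambda>(x, y, z). (y, x, z)"
  have inj: "inj_on ?p S" by (auto simp: inj_on_def)
  have "marginal2 n a j = (\<Sum>(y, x, z)\<in>?p ` S. if y = j then a x y z else 0)"
    unfolding marginal2_eq_marginal1
    by (rule marginal1_support) (use assms in \<open>force simp: triangle_idx_def\<close>)+
  also have "\<dots> = (\<Sum>(x, y, z)\<in>S. if y = j then a x y z else 0)"
    unfolding sum.reindex[OF inj] by (rule sum.cong) auto
  finally show ?thesis .
qed

lemma marginal3_support:
  assumes "finite S" "S \<subseteq> triangle_idx n" "\<forall>i j k. (i, j, k) \<notin> S \<longrightarrow> a i j k = 0"
  shows "marginal3 n a k = (\<Sum>(x, y, z)\<in>S. if z = k then a x y z else 0)"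
proof -
  let ?p = "\<lambda>(x, y, z). (z, x, y)"
  have inj: "inj_on ?p S" by (auto simp: inj_on_def)
  have "marginal3 n a k = (\<Sum>(z, x, y)\<in>?p ` S. if z = k then a x y z else 0)"
    unfolding marginal3_eq_marginal1
    by (rule marginal1_support) (use assms in \<open>force simp: triangle_idx_def\<close>)+
  also have "\<dots> = (\<Sum>(x, y, z)\<in>S. if z = k then a x y z else 0)"
    unfolding sum.reindex[OF inj] by (rule sum.cong) auto
  finally show ?thesis .
qed

section \<open>The example of size 14\<close>

definition I14 :: "nat set" where "I14 = {0, 1, 2, 4, 5, 6}"
definition J14 :: "nat set" where "J14 = {0, 1, 3, 5, 7, 8}"
definition K14 :: "nat set" where "K14 = {0, 2, 3, 9, 10, 12}"

text \<open>Each row lists the cells of one triangle: its three cells agree pairwise in one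
  coordinate, a different one for each pair.\<close>

definition cells :: "(nat \<times> nat \<times> nat) set" where
  "cells = {(0, 1, 12), (0, 3, 10), (2, 1, 10),
            (1, 3, 9), (1, 0, 12), (4, 0, 9),
            (5, 5, 3), (5, 8, 0), (2, 8, 3),
            (6, 7, 0), (6, 5, 2), (4, 7, 2)}"

definition half_table :: "nat \<Rightarrow> nat \<Rightarrow> nat \<Rightarrow> real" where
  "half_table i j k = (if (i, j, k) \<in> cells then 1 / 2 else 0)"

lemma finite_cells: "finite cells"
  by (simp add: cells_def)

lemma cells_in_triangle: "cells \<subseteq> triangle_idx 14"
  by (simp add: cells_def triangle_idx_def)

lemma cellsI:
  assumes "i \<in> I14" "j \<in> J14" "k \<in> K14" "i + j + k = 13"
  shows "(i, j, k) \<in> cells"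
proof -
  from assms(4) have "k = 13 - i - j" by simp
  with assms show ?thesis
    unfolding I14_def J14_def K14_def cells_def
    by (elim insertE emptyE; simp)
qed

lemmas marginals_on_cells =
  marginal1_support[OF finite_cells cells_in_triangle]
  marginal2_support[OF finite_cells cells_in_triangle]
  marginal3_support[OF finite_cells cells_in_triangle]

lemma triangular_half_table: "triangular_table 14 half_table"
  using cells_in_triangle by (auto simp: triangular_table_def half_table_def)

lemma has_marginals_half_table:
  "has_marginals 14 half_table (indicator I14) (indicator J14) (indicator K14)"
proof -
  have vanish: "\<forall>i j k. (i, j, k) \<notin> cells \<longrightarrow> half_table i j k = 0"
    by (simp add: half_table_def)
  have half: "(\<Sum>(x, y, z)\<in>cells. if P x y z then half_table x y z else 0) =
      (\<Sum>(x, y, z)\<in>cells. if P x y z then 1 / 2 else 0)" for P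
    by (intro sum.cong) (auto simp: half_table_def)
  have all_less_14:
    "(\<forall>i<14. P i) \<longleftrightarrow> (\<forall>i\<in>{0, 1, 2, 3, 4, 5, 6, 7, 8, 9, 10, 11, 12, 13}. P i)"
    for P :: "nat \<Rightarrow> bool"
    by (simp add: numeral_eq_Suc All_less_Suc conj_ac)
  show ?thesis
    unfolding has_marginals_def all_less_14
      marginals_on_cells[OF vanish] half
    by (simp add: cells_def I14_def J14_def K14_def)
qed

lemma support_in_cells:
  assumes "triangular_table 14 b"
    and "has_marginals 14 b (indicator I14) (indicator J14) (indicator K14)"
    and "(i, j, k) \<notin> cells"
  shows "b i j k = 0"
proof (cases "i + j + k = 13")
  case True
  then have "i < 14" "j < 14" "k < 14" by simp_all
  from cellsI[of i j k] True assms(3) consider "i \<notin> I14" | "j \<notin> J14" | "k \<notin> K14" by blast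
  then show ?thesis
  proof cases
    case 1
    with assms(2) \<open>i < 14\<close> have "marginal1 14 b i = 0" by (simp add: has_marginals_def)
    from triangular_table_zero_line[OF assms(1) this] show ?thesis .
  next
    case 2
    with assms(2) \<open>j < 14\<close> have "marginal2 14 b j = 0" by (simp add: has_marginals_def)
    from triangular_table_zero_line[OF triangular_table_permute(1)[OF assms(1)]
        this[unfolded marginal2_eq_marginal1]]
    show ?thesis .
  next
    case 3
    with assms(2) \<open>k < 14\<close> have "marginal3 14 b k = 0" by (simp add: has_marginals_def)
    from triangular_table_zero_line[OF triangular_table_permute(2)[OF assms(1)]
        this[unfolded marginal3_eq_marginal1]]
    show ?thesis .
  qed
next
  case False
  with assms(1) show ?thesis by (simp add: triangular_table_def triangle_idx_def)
qed

lemma half_table_unique: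
  assumes "triangular_table 14 b"
    and "has_marginals 14 b (indicator I14) (indicator J14) (indicator K14)"
  shows "b = half_table"
proof -
  have vanish: "\<forall>i j k. (i, j, k) \<notin> cells \<longrightarrow> b i j k = 0"
    using support_in_cells[OF assms] by blast
  note sums = marginals_on_cells[OF vanish, symmetric]
  have lines1: "\<forall>i\<in>I14. (\<Sum>(x, y, z)\<in>cells. if x = i then b x y z else 0) = 1"
    using assms(2) unfolding sums by (simp add: has_marginals_def I14_def)
  have lines2: "\<forall>j\<in>J14. (\<Sum>(x, y, z)\<in>cells. if y = j then b x y z else 0) = 1"
    using assms(2) unfolding sums by (simp add: has_marginals_def J14_def)
  have lines3: "\<forall>k\<in>K14. (\<Sum>(x, y, z)\<in>cells. if z = k then b x y z else 0) = 1"
    using assms(2) unfolding sums by (simp add: has_marginals_def K14_def)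
  note eqs = lines1 lines2 lines3
  have triangle: "x = 1 / 2 \<and> y = 1 / 2 \<and> z = 1 / 2"
    if "x + y = 1" "y + z = 1" "x + z = 1" for x y z :: real
    using that by linarith
  have "b 0 1 12 = 1/2 \<and> b 0 3 10 = 1/2 \<and> b 2 1 10 = 1/2"
    by (rule triangle) (use eqs in \<open>simp_all add: I14_def J14_def K14_def cells_def\<close>)
  moreover have "b 1 3 9 = 1/2 \<and> b 1 0 12 = 1/2 \<and> b 4 0 9 = 1/2"
    by (rule triangle) (use eqs in \<open>simp_all add: I14_def J14_def K14_def cells_def\<close>)
  moreover have "b 5 5 3 = 1/2 \<and> b 5 8 0 = 1/2 \<and> b 2 8 3 = 1/2"
    by (rule triangle) (use eqs in \<open>simp_all add: I14_def J14_def K14_def cells_def\<close>)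
  moreover have "b 6 7 0 = 1/2 \<and> b 6 5 2 = 1/2 \<and> b 4 7 2 = 1/2"
    by (rule triangle) (use eqs in \<open>simp_all add: I14_def J14_def K14_def cells_def\<close>)
  ultimately have "b i j k = 1/2" if "(i, j, k) \<in> cells" for i j k
    using that by (auto simp: cells_def)
  with vanish show ?thesis by (intro ext) (simp add: half_table_def)
qed

lemma half_table_not_integer_valued: "\<not> integer_valued 14 half_table"
proof
  assume "integer_valued 14 half_table"
  moreover have "(0, 1, 12) \<in> triangle_idx 14" by (simp add: triangle_idx_def)
  ultimately have "half_table 0 1 12 \<in> \<int>" by (auto simp: integer_valued_def)
  then obtain m :: int where "1 / 2 = real_of_int m"
    by (auto simp: half_table_def cells_def elim: Ints_cases)
  then have "real_of_int (2 * m) = real_of_int 1" by simp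
  then have "2 * m = 1" unfolding of_int_eq_iff .
  then show False by presburger
qed

theorem proposition5p4:
  "\<exists>(n::nat) (lam :: nat \<Rightarrow> real) (mu :: nat \<Rightarrow> real) (nu :: nat \<Rightarrow> real).
     n > 0 \<and>
     (\<forall>i<n. lam i \<in> {0, 1}) \<and> (\<forall>j<n. mu j \<in> {0, 1}) \<and> (\<forall>k<n. nu k \<in> {0, 1}) \<and>
     (\<exists>a. triangular_table n a \<and> has_marginals n a lam mu nu \<and>
          (\<forall>b. triangular_table n b \<and> has_marginals n b lam mu nu \<longrightarrow> b = a) \<and>
          \<not> integer_valued n a)"
proof (intro exI conjI)
  show "triangular_table 14 half_table" by (rule triangular_half_table)
  show "has_marginals 14 half_table (indicator I14) (indicator J14) (indicator K14)"
    by (rule has_marginals_half_table)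
  show "\<not> integer_valued 14 half_table" by (rule half_table_not_integer_valued)
qed (use half_table_unique in \<open>auto simp: indicator_def\<close>)

end
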